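(* Let $(x_n)_{n\ge0}$ be the $\mathbb R^d$-valued iterates $x_{n+1}=x_n+a(n)[h(x_n)+M_{n+1}]$, and assume: (A1) $h:\mathbb R^d\to\mathbb R^d$ is Lipschitz; (A2) $a(n)>0$, $\sum_n a(n)=\infty$, $\sum_n a(n)^2<\infty$, and there is $c>0$ such that $a(n)\le c\,a(m)$ for all $n\ge m$; (A3) $(M_n)_{n\ge1}$ is a square integrable martingale difference sequence with respect to $\mathcal F_n=\sigma(x_0,M_1,\ldots,M_n)$, i.e. $E[M_{n+1}\mid\mathcal F_n]=0$ a.s. for all $n\ge0$, and $E[\|M_{n+1}\|^2\mid\mathcal F_n]\le c(1+\|x_n\|^2)$ a.s. for all $n\ge 0$ and some $0<c<\infty$. Let $V$ and $H$ be the Liapunov function and the compact set described in the context. If the iterates $\{x_n\}$ are tight, then $x_n\rightarrow H$ almost surely.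
   Context: $V:\mathbb R^d\to[0,\infty)$ is differentiable with $\lim_{\|x\|\uparrow\infty}V(x)=\infty$ and $\nabla V(x)\cdot h(x)\le 0$ for all $x$. $H:=\{x:\nabla V(x)\cdot h(x)=0\}$ is assumed to coincide with $\{x:V(x)=0\}$ (so $H$ is compact). $x_n\to H$ means that the distance from $x_n$ to $H$ tends to $0$. The iterates $\{x_n\}$ are tight if for every $\epsilon>0$ there is a compact $K\subset\mathbb R^d$ with $\mathbb P[x_n\in K]>1-\epsilon$ for all $n$. *)

theory Defs
  imports "HOL-Probability.Probability"
begin

definition noise_filtration ::
  "'w measure \<Rightarrow> ('w \<Rightarrow> real ^ 'd) \<Rightarrow> (nat \<Rightarrow> 'w \<Rightarrow> real ^ 'd) \<Rightarrow> nat \<Rightarrow> 'w measure" where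
  "noise_filtration P X0 M n = sigma (space P)
     ({X0 -` A \<inter> space P | A. A \<in> sets borel} \<union>
      {M k -` A \<inter> space P | k A. k \<in> {1..n} \<and> A \<in> sets borel})"

definition vec_cond_exp ::
  "'w measure \<Rightarrow> 'w measure \<Rightarrow> ('w \<Rightarrow> real ^ 'd) \<Rightarrow> 'w \<Rightarrow> real ^ 'd" where
  "vec_cond_exp P F X w = (\<chi> i. real_cond_exp P F (\<lambda>v. X v $ i) w)"

(* The library's notion "tight" concerns sequences of measures on the real line only. *)
definition tight_iterates :: "'w measure \<Rightarrow> (nat \<Rightarrow> 'w \<Rightarrow> real ^ 'd) \<Rightarrow> bool" where
  "tight_iterates P x \<longleftrightarrow>
     (\<forall>\<epsilon>>0. \<exists>K. compact K \<and> (\<forall>n. measure P {w \<in> space P. x n w \<in> K} > 1 - \<epsilon>))"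

end

theory Submission
  imports Defs
begin

text \<open>
  Two facts hold almost surely, and on the event where both hold the convergence is a deterministic
  statement about a single path.

  First, the noise is harmless as long as the iterates stay bounded. For a bounded Borel set \<open>B\<close> the
  truncated terms \<open>a n *\<^sub>R M (Suc n)\<close>, kept only at the times with \<open>x n \<in> B\<close>, are martingale
  differences, because the truncation at time \<open>n\<close> is decided by the past. Their second moments are
  at most a constant times \<open>(a n)\<^sup>2\<close>, hence summable, and the maximal inequality
  (\<open>maximal_inequality\<close>) makes the series converge almost surely
  (\<open>AE_truncated_noise_summable\<close>). Countably many sublevel sets of \<open>V\<close> serve as \<open>B\<close>.

  Second, the iterates do not escape to infinity: by tightness each of the events
  \<open>x n \<in> K\<close> has probability near 1, so infinitely many of them occur together with probability near 1.
  Almost surely the path therefore returns infinitely often to some bounded set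
  (\<open>tight_iterates_imp_AE_recurrent\<close>).

  For one such path, \<open>V\<close> plays the role of an energy. If the path comes close to a point \<open>p\<close>
  with \<open>V p > 0\<close>, then it follows the direction \<open>h p\<close> for a short while, and differentiability of \<open>V\<close>
  at \<open>p\<close> together with \<open>grad_V p \<bullet> h p < 0\<close> forces \<open>V\<close> to drop by a fixed amount without
  having risen noticeably on the way (\<open>descent_near\<close>). This compares the path with the straight
  line in direction \<open>h p\<close> over a short time, so that first order information on \<open>V\<close> at the single
  point \<open>p\<close> suffices. Recurrence and compactness of the sublevel sets supply
  cluster points. A cluster point at a positive lower limit of \<open>V\<close> would contradict the drop
  (\<open>frequently_V_below\<close>), and so would a cluster point of the starting times of infinitely many
  upcrossings of an interval \<open>[\<alpha>, \<beta>]\<close> with \<open>0 < \<alpha>\<close> (\<open>eventually_V_below\<close>). Hence \<open>V\<close> tends to 0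
  along the path, and properness of \<open>V\<close> turns this into convergence to the zero set of \<open>V\<close>.
\<close>

section \<open>Perturbed Euler paths descend a Liapunov function\<close>

lemma compact_sublevel:
  fixes V :: "'a::euclidean_space \<Rightarrow> real"
  assumes cont: "continuous_on UNIV V" and inf: "filterlim V at_top at_infinity"
  shows "compact {p. V p \<le> R}"
proof -
  have "closed {p. V p \<le> R}"
    using cont by (intro closed_Collect_le) auto
  moreover have "\<forall>\<^sub>F p in at_infinity. R < V p"
    using inf by (simp add: filterlim_at_top_dense)
  then obtain b where b: "\<And>p. b \<le> norm p \<Longrightarrow> R < V p"
    by (auto simp: eventually_at_infinity)
  have "bounded {p. V p \<le> R}"
    by (rule boundedI[where B = b]) (use b in \<open>force simp: not_le[symmetric]\<close>)
  ultimately show ?thesis by (simp add: compact_eq_bounded_closed)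
qed

text \<open>
  The perturbation \<open>e\<close> is assumed summable only after truncation to sublevel sets of \<open>V\<close>, since
  boundedness of the path is part of what has to be shown. Truncation levels are natural numbers so
  that a random path satisfies all these conditions at once outside a single null set.
\<close>

locale noisy_euler_path =
  fixes h :: "'a::euclidean_space \<Rightarrow> 'a"
    and V :: "'a \<Rightarrow> real" and grad_V :: "'a \<Rightarrow> 'a"
    and a :: "nat \<Rightarrow> real" and y e :: "nat \<Rightarrow> 'a"
  assumes h_cont: "continuous_on UNIV h"
    and V_nonneg: "\<And>p. V p \<ge> 0"
    and V_grad: "\<And>p. GDERIV V p :> grad_V p"
    and V_inf: "filterlim V at_top at_infinity"
    and V_descent: "\<And>p. V p > 0 \<Longrightarrow> grad_V p \<bullet> h p < 0"
    and step: "\<And>n. y (Suc n) = y n + a n *\<^sub>R h (y n) + e n"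
    and a_pos: "\<And>n. a n > 0"
    and a_lim: "a \<longlonglongrightarrow> 0"
    and a_sum: "filterlim (\<lambda>N. \<Sum>n<N. a n) at_top sequentially"
    and noise: "\<And>i::nat. summable (\<lambda>n. if V (y n) \<le> real i then e n else 0)"
    and recurrent: "\<exists>R. \<exists>\<^sub>F n in sequentially. V (y n) \<le> R"
begin

lemma V_cont: "continuous_on S V"
  using V_grad unfolding gderiv_def
  by (meson continuous_at_imp_continuous_on has_derivative_continuous)

lemma V_isCont: "isCont V p"
  using V_cont[of UNIV] by (simp add: continuous_on_eq_continuous_at)

lemma h_isCont: "isCont h p"
  using h_cont by (simp add: continuous_on_eq_continuous_at)

lemma compact_sublevel_V: "compact {p. V p \<le> R}"
  using V_cont V_inf by (rule compact_sublevel)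

lemma ex_cluster_point:
  assumes "\<exists>\<^sub>F n in sequentially. Q n" and bd: "\<And>n. Q n \<Longrightarrow> V (y n) \<le> R"
  obtains \<sigma> p where "strict_mono \<sigma>" "\<And>j. Q (\<sigma> j)" "(\<lambda>j. y (\<sigma> j)) \<longlonglongrightarrow> p"
proof -
  have inf: "infinite {n. Q n}"
    using assms(1) by (simp add: cofinite_eq_sequentially[symmetric] frequently_cofinite)
  let ?s = "enumerate {n. Q n}"
  have sQ: "Q (?s j)" for j
    using enumerate_in_set[OF inf] by auto
  have "\<forall>j. y (?s j) \<in> {p. V p \<le> R}" using sQ bd by auto
  then obtain p r where r: "strict_mono r" "((\<lambda>j. y (?s j)) \<circ> r) \<longlonglongrightarrow> p"
    using compact_sublevel_V[of R] unfolding compact_def by metis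
  show ?thesis
  proof
    show "strict_mono (?s \<circ> r)"
      using inf r(1) by (intro strict_mono_o strict_mono_enumerate)
  qed (use sQ r in \<open>auto simp: o_def\<close>)
qed

text \<open>
  Let \<open>s\<close> be the total step size accumulated since time \<open>m\<close>. As long as the path stays in a small ball
  around \<open>p\<close>, continuity of \<open>h\<close> and smallness of the tails of the noise make the displacement equal to
  \<open>s *\<^sub>R h p\<close> up to an error of order \<open>\<kappa> * (s + t)\<close>, and this bound in turn keeps the path in the ball until
  \<open>s\<close> has passed the threshold \<open>t\<close>. At that moment the linearisation of \<open>V\<close> at \<open>p\<close> has decreased by
  \<open>2 * \<eta> * s\<close>, of which all the errors together consume at most \<open>\<eta> * s\<close>.
\<close>

lemma descent_near:
  assumes Vp: "V p > 0" and \<epsilon>: "\<epsilon> > 0"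
  obtains \<Delta> r where "\<Delta> > 0" "r > 0"
    "\<forall>\<^sub>F m in sequentially. dist (y m) p < r \<longrightarrow>
       (\<exists>n>m. V (y n) \<le> V p - \<Delta> \<and> (\<forall>k\<in>{m..n}. V (y k) < V p + \<epsilon>))"
proof -
  define g where "g = grad_V p"
  define \<eta> where "\<eta> = - (g \<bullet> h p) / 2"
  have \<eta>: "\<eta> > 0" "g \<bullet> h p = - (2 * \<eta>)"
    using V_descent[OF Vp] by (auto simp: \<eta>_def g_def)
  \<comment> \<open>\<open>\<kappa> * C * s\<close> will bound the total error: \<open>3 * \<kappa> * s * norm g\<close> from the displacement tested
      against the gradient, and \<open>\<kappa> * norm (y n - p)\<close> from the linearisation of \<open>V\<close>.\<close>
  define C where "C = 3 * norm g + norm (h p) + 3"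
  have C: "C > 0" using norm_ge_zero[of g] norm_ge_zero[of "h p"] unfolding C_def by linarith
  define \<kappa> where "\<kappa> = min 1 (\<eta> / C)"
  have \<kappa>: "\<kappa> > 0" "\<kappa> \<le> 1" "\<kappa> * C \<le> \<eta>"
    using \<eta> C by (auto simp: \<kappa>_def min_def field_simps)
  have "\<forall>\<^sub>F q in nhds p. V q < V p + \<epsilon> \<and> dist (h q) (h p) < \<kappa> \<and>
      norm (V q - V p - (q - p) \<bullet> g) \<le> \<kappa> * norm (q - p)"
  proof (intro eventually_conj)
    show "\<forall>\<^sub>F q in nhds p. V q < V p + \<epsilon>"
      using V_isCont[of p] \<epsilon> by (intro order_tendstoD) (auto simp: isCont_def tendsto_at_iff_tendsto_nhds)
    show "\<forall>\<^sub>F q in nhds p. dist (h q) (h p) < \<kappa>"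
      using \<kappa> h_isCont[of p] by (intro tendstoD) (auto simp: isCont_def tendsto_at_iff_tendsto_nhds)
    have "(V has_derivative (\<lambda>q. q \<bullet> g)) (at p)"
      using V_grad unfolding g_def gderiv_def .
    then obtain d where "d > 0" "\<forall>q. norm (q - p) < d \<longrightarrow>
        norm (V q - V p - (q - p) \<bullet> g) \<le> \<kappa> * norm (q - p)"
      using \<kappa> unfolding has_derivative_at_alt by meson
    then show "\<forall>\<^sub>F q in nhds p. norm (V q - V p - (q - p) \<bullet> g) \<le> \<kappa> * norm (q - p)"
      by (auto simp: eventually_nhds_metric dist_norm)
  qed
  then obtain \<rho> where "\<rho> > 0"
    and V\<rho>: "\<And>q. dist q p < \<rho> \<Longrightarrow> V q < V p + \<epsilon>"
    and h\<rho>: "\<And>q. dist q p < \<rho> \<Longrightarrow> norm (h q - h p) \<le> \<kappa>"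
    and D\<rho>: "\<And>q. dist q p < \<rho> \<Longrightarrow> norm (V q - V p - (q - p) \<bullet> g) \<le> \<kappa> * norm (q - p)"
    by (auto simp: eventually_nhds_metric dist_norm less_imp_le)
  \<comment> \<open>Steps shorter than \<open>t\<close> overshoot the threshold \<open>t\<close> to at most \<open>2 * t\<close>; moving for that long at
      speed at most \<open>norm (h p) + 3\<close>, all errors included, stays in the ball of radius \<open>\<rho>\<close>.\<close>
  define t where "t = \<rho> / (4 * (norm (h p) + 3))"
  have pos3: "norm (h p) + 3 > 0" using norm_ge_zero[of "h p"] by linarith
  have "t > 0" using \<open>\<rho> > 0\<close> pos3 by (simp add: t_def)
  moreover have "2 * t * (norm (h p) + 3) = \<rho> / 2"
    using pos3 unfolding t_def times_divide_eq_right times_divide_eq_left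
    by (subst frac_eq_eq) (auto simp: algebra_simps)
  ultimately have t: "t > 0" "2 * t * (norm (h p) + 3) < \<rho>"
    using \<open>\<rho> > 0\<close> by linarith+
  obtain i :: nat where i: "V p + \<epsilon> \<le> i" using real_arch_simple by blast
  define z where "z n = (if V (y n) \<le> i then e n else 0)" for n
  have sz: "summable z" unfolding z_def by (rule noise)
  have \<kappa>t: "\<kappa> * t > 0" using \<kappa> t by simp
  obtain N1 where N1: "\<And>m n. m \<ge> N1 \<Longrightarrow> norm (sum z {m..<n}) < \<kappa> * t"
    using sz \<kappa>t unfolding summable_Cauchy by meson
  obtain N2 where N2: "\<And>m. m \<ge> N2 \<Longrightarrow> a m < t"
    using order_tendstoD(2)[OF a_lim t(1)] by (auto simp: eventually_sequentially)
  have main: "\<exists>n>m. V (y n) \<le> V p - \<eta> * t \<and> (\<forall>k\<in>{m..n}. V (y k) < V p + \<epsilon>)"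
    if m: "m \<ge> N1" "m \<ge> N2" and near: "dist (y m) p < \<kappa> * t" for m
  proof -
    define s where "s n = sum a {m..<n}" for n
    have s_Suc: "s (Suc n) = s n + a n" if "n \<ge> m" for n
      using that by (simp add: s_def)
    have s_nonneg: "s n \<ge> 0" for n
      unfolding s_def by (intro sum_nonneg) (simp add: a_pos less_imp_le)
    have "\<exists>n. s n \<ge> t"
    proof -
      obtain N where N: "\<And>n. n \<ge> N \<Longrightarrow> (\<Sum>k<n. a k) \<ge> t + (\<Sum>k<m. a k)"
        using a_sum by (auto simp: filterlim_at_top eventually_sequentially)
      have "s (max N m) = (\<Sum>k<max N m. a k) - (\<Sum>k<m. a k)"
        unfolding s_def lessThan_atLeast0
        by (subst sum_diff_nat_ivl[symmetric, of 0 m]) auto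
      then have "s (max N m) \<ge> t" using N[of "max N m"] by simp
      then show ?thesis ..
    qed
    define n where "n = (LEAST n. s n \<ge> t)"
    have sn: "s n \<ge> t" unfolding n_def using \<open>\<exists>n. s n \<ge> t\<close> by (rule LeastI_ex)
    have lt_n: "s k < t" if "k < n" for k
      using not_less_Least[of k "\<lambda>n. s n \<ge> t"] that by (simp add: n_def)
    have "n > m" using sn t by (cases "n > m") (auto simp: s_def)
    have s_le: "s k \<le> 2 * t" if "k \<in> {m..n}" for k
    proof (cases "k = m")
      case True then show ?thesis using t by (simp add: s_def)
    next
      case False
      then have "s k = s (k - 1) + a (k - 1)" "k - 1 < n" "k - 1 \<ge> m" 
        using that s_Suc[of "k - 1"] by auto
      then show ?thesis using lt_n[of "k - 1"] N2[of "k - 1"] m by linarith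
    qed
    \<comment> \<open>The part of the displacement that is due neither to the drift frozen at \<open>p\<close> nor to the noise.\<close>
    define D where "D k = y k - y m - s k *\<^sub>R h p - sum z {m..<k}" for k
    have close: "dist (y k) p < \<rho>" "norm (y k - p) \<le> s k * (norm (h p) + \<kappa>) + 2 * \<kappa> * t"
      if "norm (D k) \<le> \<kappa> * s k" "k \<in> {m..n}" for k
    proof -
      have "y k - p = (y m - p) + s k *\<^sub>R h p + sum z {m..<k} + D k"
        by (simp add: D_def)
      then have "norm (y k - p) \<le> norm (y m - p) + norm (s k *\<^sub>R h p) + norm (sum z {m..<k}) + norm (D k)"
        by (simp only:) (intro norm_triangle_mono order_refl)
      also have "\<dots> \<le> \<kappa> * t + s k * norm (h p) + \<kappa> * t + \<kappa> * s k"
        using near N1[OF m(1), of k] that s_nonneg[of k] by (simp add: dist_norm)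
      finally show *: "norm (y k - p) \<le> s k * (norm (h p) + \<kappa>) + 2 * \<kappa> * t"
        by (simp add: algebra_simps)
      have "s k * (norm (h p) + \<kappa>) \<le> 2 * t * (norm (h p) + 1)"
        using s_le[OF that(2)] \<kappa> s_nonneg[of k] by (intro mult_mono) auto
      moreover have "2 * \<kappa> * t \<le> 2 * t * 1" using \<kappa> t by simp
      ultimately have "norm (y k - p) \<le> 2 * t * (norm (h p) + 2)"
        using * by (simp add: algebra_simps)
      also have "\<dots> < \<rho>" using t by (smt (verit) mult_left_mono)
      finally show "dist (y k) p < \<rho>" by (simp add: dist_norm)
    qed
    have Dk: "norm (D k) \<le> \<kappa> * s k" if "k \<in> {m..n}" for k
    proof -
      have "m \<le> k" "k \<le> n" using that by auto
      then show ?thesis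
      proof (induction k rule: dec_induct)
        case base then show ?case by (simp add: D_def s_def)
      next
        case (step k)
        then have IH: "norm (D k) \<le> \<kappa> * s k" and k: "k \<in> {m..n}" by auto
        have near_k: "dist (y k) p < \<rho>" using close(1)[OF IH k] .
        \<comment> \<open>Inside the ball the truncation of the noise is not active.\<close>
        have "z k = e k" using V\<rho>[OF near_k] i by (simp add: z_def)
        then have "D (Suc k) = D k + a k *\<^sub>R (h (y k) - h p)"
          using step.hyps s_Suc[of k]
          by (simp add: D_def noisy_euler_path.step[OF noisy_euler_path_axioms] algebra_simps)
        then have "norm (D (Suc k)) \<le> norm (D k) + a k * norm (h (y k) - h p)"
          using a_pos[of k] by (metis abs_of_pos norm_scaleR norm_triangle_ineq)
        also have "\<dots> \<le> \<kappa> * s k + a k * \<kappa>"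
          using IH h\<rho>[OF near_k] a_pos[of k] by (intro add_mono mult_left_mono) auto
        also have "\<dots> = \<kappa> * s (Suc k)" using s_Suc[of k] step.hyps by (simp add: algebra_simps)
        finally show ?case .
      qed
    qed
    have n_in: "n \<in> {m..n}" using \<open>n > m\<close> by auto
    have \<kappa>s: "\<kappa> * t \<le> \<kappa> * s n" using sn \<kappa> by simp
    define E where "E = (y m - p) + sum z {m..<n} + D n"
    have E: "norm E \<le> 3 * \<kappa> * s n"
    proof -
      have "norm E \<le> norm (y m - p) + norm (sum z {m..<n}) + norm (D n)"
        unfolding E_def by (intro norm_triangle_mono order_refl)
      then show ?thesis
        using near N1[OF m(1), of n] Dk[OF n_in] \<kappa>s by (simp add: dist_norm)
    qed
    have "(y n - p) \<bullet> g = s n * (h p \<bullet> g) + E \<bullet> g"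
      by (simp add: E_def D_def algebra_simps)
    also have "\<dots> \<le> - (2 * \<eta> * s n) + 3 * \<kappa> * s n * norm g"
      using \<eta>(2) norm_cauchy_schwarz[of E g] mult_right_mono[OF E, of "norm g"]
      by (simp add: inner_commute[of _ g] algebra_simps)
    finally have lin: "(y n - p) \<bullet> g \<le> - (2 * \<eta> * s n) + 3 * \<kappa> * s n * norm g" .
    have "norm (y n - p) \<le> s n * (norm (h p) + 3)"
    proof -
      have "2 * \<kappa> * t \<le> 2 * 1 * s n" using \<kappa> sn t by (intro mult_mono) auto
      moreover have "s n * (norm (h p) + \<kappa>) \<le> s n * (norm (h p) + 1)"
        using \<kappa> s_nonneg by (intro mult_left_mono) auto
      ultimately show ?thesis using close(2)[OF Dk[OF n_in] n_in] by (simp add: algebra_simps)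
    qed
    then have "\<kappa> * norm (y n - p) \<le> \<kappa> * (s n * (norm (h p) + 3))"
      using \<kappa> by (intro mult_left_mono) auto
    then have "V (y n) \<le> V p - 2 * \<eta> * s n + (\<kappa> * C) * s n"
      using D\<rho>[OF close(1)[OF Dk[OF n_in] n_in]] lin by (simp add: C_def algebra_simps abs_le_iff)
    also have "\<dots> \<le> V p - 2 * \<eta> * s n + \<eta> * s n"
      using \<kappa>(3) s_nonneg[of n] by (simp add: mult_right_mono)
    also have "\<dots> \<le> V p - \<eta> * t"
      using mult_left_mono[OF sn, of \<eta>] \<eta>(1) by simp
    finally have "V (y n) \<le> V p - \<eta> * t" .
    moreover have "\<forall>k\<in>{m..n}. V (y k) < V p + \<epsilon>"
      using V\<rho> close(1) Dk by blast
    ultimately show ?thesis using \<open>n > m\<close> by blast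
  qed
  show ?thesis
  proof
    show "\<eta> * t > 0" "\<kappa> * t > 0" using \<eta> t \<kappa>t by auto
    show "\<forall>\<^sub>F m in sequentially. dist (y m) p < \<kappa> * t \<longrightarrow>
       (\<exists>n>m. V (y n) \<le> V p - \<eta> * t \<and> (\<forall>k\<in>{m..n}. V (y k) < V p + \<epsilon>))"
      using main by (intro eventually_sequentiallyI[of "max N1 N2"]) auto
  qed
qed

text \<open>
  The lower limit of \<open>V\<close> along the path is finite by recurrence, and it is attained at a cluster point
  \<open>p\<close> of the path. If it were positive, the descent near \<open>p\<close> would take the path below it infinitely
  often.
\<close>

lemma frequently_V_below:
  assumes "c > 0"
  shows "\<exists>\<^sub>F n in sequentially. V (y n) < c"
proof -
  \<comment> \<open>\<open>Inf A\<close> is the lower limit of \<open>V\<close> along the path.\<close>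
  define A where "A = {c. \<exists>\<^sub>F n in sequentially. V (y n) \<le> c}"
  have A0: "0 \<le> c" if "c \<in> A" for c
  proof -
    have "\<exists>n. V (y n) \<le> c" using that unfolding A_def by (intro frequently_ex) simp
    then obtain n where "V (y n) \<le> c" ..
    then show ?thesis using V_nonneg[of "y n"] by linarith
  qed
  have ne: "A \<noteq> {}" and bdd: "bdd_below A"
    using recurrent bdd_belowI[of A 0] A0 by (auto simp: A_def)
  have "Inf A = 0"
  proof (rule ccontr)
    assume "Inf A \<noteq> 0"
    then have pos: "Inf A > 0" using cInf_greatest[OF ne A0] by simp
    have up: "\<exists>\<^sub>F n in sequentially. V (y n) < d" if d: "d > Inf A" for d
    proof -
      obtain c where c: "c \<in> A" "c < d" using d cInf_lessD[OF ne] by blast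
      have "\<exists>\<^sub>F n in sequentially. V (y n) \<le> c" using c by (simp add: A_def)
      then show ?thesis by (rule frequently_elim1) (use c in auto)
    qed
    have low: "\<forall>\<^sub>F n in sequentially. V (y n) > d" if d: "d < Inf A" for d
    proof -
      have "d \<notin> A" using d cInf_lower[OF _ bdd, of d] by linarith
      then show ?thesis by (simp add: A_def frequently_def not_le)
    qed
    have "\<exists>n\<ge>k. V (y n) < Inf A + 1 / Suc k" for k
      using up[of "Inf A + 1 / Suc k"] by (simp add: frequently_sequentially)
    then obtain \<tau> where \<tau>: "\<And>k. \<tau> k \<ge> k" "\<And>k. V (y (\<tau> k)) < Inf A + 1 / Suc k" by metis
    have \<tau>lim: "filterlim \<tau> sequentially sequentially"
      using \<tau>(1) by (intro filterlim_at_top_mono[OF filterlim_ident]) auto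
    have V\<tau>: "(\<lambda>k. V (y (\<tau> k))) \<longlonglongrightarrow> Inf A"
    proof (rule order_tendstoI)
      fix d assume "d < Inf A"
      from low[OF this] show "\<forall>\<^sub>F k in sequentially. d < V (y (\<tau> k))"
        using \<tau>lim by (rule eventually_compose_filterlim)
    next
      fix d assume "Inf A < d"
      have "(\<lambda>k. Inf A + 1 / Suc k) \<longlonglongrightarrow> Inf A + 0"
        by (intro tendsto_intros LIMSEQ_Suc[OF lim_1_over_n])
      then have "\<forall>\<^sub>F k in sequentially. Inf A + 1 / Suc k < d"
        using \<open>Inf A < d\<close> by (intro order_tendstoD(2)) auto
      then show "\<forall>\<^sub>F k in sequentially. V (y (\<tau> k)) < d"
        by eventually_elim (use \<tau>(2) in \<open>meson less_trans\<close>)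
    qed
    have "\<forall>k. y (\<tau> k) \<in> {p. V p \<le> Inf A + 1}"
    proof
      fix k :: nat
      have "1 / Suc k \<le> (1::real)" by simp
      then show "y (\<tau> k) \<in> {p. V p \<le> Inf A + 1}" using \<tau>(2)[of k] by (simp only: mem_Collect_eq)
    qed
    then obtain p r where r: "strict_mono r" "((\<lambda>k. y (\<tau> k)) \<circ> r) \<longlonglongrightarrow> p"
      using compact_sublevel_V[of "Inf A + 1"] unfolding compact_def by metis
    have "(\<lambda>j. V (y (\<tau> (r j)))) \<longlonglongrightarrow> V p"
      using isCont_tendsto_compose[OF V_isCont r(2)] by (simp add: o_def)
    moreover have "(\<lambda>j. V (y (\<tau> (r j)))) \<longlonglongrightarrow> Inf A"
      using LIMSEQ_subseq_LIMSEQ[OF V\<tau> r(1)] by (simp add: o_def)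
    ultimately have Vp: "V p = Inf A" by (rule LIMSEQ_unique)
    obtain \<Delta> \<rho> where \<Delta>: "\<Delta> > 0" "\<rho> > 0" and ev: "\<forall>\<^sub>F m in sequentially. dist (y m) p < \<rho> \<longrightarrow>
       (\<exists>n>m. V (y n) \<le> V p - \<Delta> \<and> (\<forall>k\<in>{m..n}. V (y k) < V p + 1))"
      using descent_near[of p 1] Vp pos by auto
    have \<sigma>: "filterlim (\<lambda>j. \<tau> (r j)) sequentially sequentially"
      using filterlim_compose[OF \<tau>lim filterlim_subseq[OF r(1)]] .
    obtain N where N: "\<And>n. n \<ge> N \<Longrightarrow> V (y n) > V p - \<Delta>"
      using low[of "V p - \<Delta>"] \<Delta> Vp by (auto simp: eventually_sequentially)
    have "\<forall>\<^sub>F j in sequentially. dist (y (\<tau> (r j))) p < \<rho> \<and> \<tau> (r j) \<ge> N \<and>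
       (\<exists>n>\<tau> (r j). V (y n) \<le> V p - \<Delta>)"
    proof -
      have 1: "\<forall>\<^sub>F j in sequentially. dist (y (\<tau> (r j))) p < \<rho>"
        using tendstoD[OF r(2) \<Delta>(2)] by simp
      have 2: "\<forall>\<^sub>F j in sequentially. \<tau> (r j) \<ge> N"
        using \<sigma> by (simp add: filterlim_at_top)
      show ?thesis
        using 1 2 eventually_compose_filterlim[OF ev \<sigma>] by eventually_elim blast
    qed
    then obtain j n where "\<tau> (r j) \<ge> N" "n > \<tau> (r j)" "V (y n) \<le> V p - \<Delta>"
      using eventually_happens'[OF sequentially_bot] by blast
    then show False using N[of n] by simp
  qed
  then obtain d where "d \<in> A" "d < c" using cInf_lessD[OF ne] assms by metis
  then have "\<exists>\<^sub>F n in sequentially. V (y n) \<le> d" by (simp add: A_def)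
  then show ?thesis by (rule frequently_elim1) (use \<open>d < c\<close> in auto)
qed

text \<open>
  Otherwise the path would climb from below \<open>\<alpha>\<close> to above \<open>\<beta>\<close> infinitely often. Let \<open>p\<close> be a cluster
  point of the positions at the last visits below \<open>\<alpha>\<close> before such climbs. Single steps tend to 0
  there, so \<open>V p = \<alpha> > 0\<close>. The descent near \<open>p\<close> brings the path below \<open>\<alpha>\<close> again before it reaches \<open>\<beta>\<close>,
  which contradicts the choice of the last visit.
\<close>

lemma eventually_V_below:
  assumes \<beta>: "\<beta> > 0"
  shows "\<forall>\<^sub>F n in sequentially. V (y n) < \<beta>"
proof (rule ccontr)
  assume "\<not> ?thesis"
  then have high: "\<exists>\<^sub>F n in sequentially. V (y n) \<ge> \<beta>"
    by (simp add: frequently_def not_le)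
  define \<alpha> where "\<alpha> = \<beta> / 2"
  have \<alpha>: "0 < \<alpha>" "\<alpha> < \<beta>" using \<beta> by (auto simp: \<alpha>_def)
  \<comment> \<open>\<open>Q p\<close>: time \<open>p\<close> is the last visit below \<open>\<alpha>\<close> before an ascent to level \<open>\<beta>\<close>.\<close>
  define Q where "Q p \<longleftrightarrow> V (y p) \<le> \<alpha> \<and> (\<exists>q>p. V (y q) \<ge> \<beta> \<and> (\<forall>k\<in>{p<..<q}. V (y k) > \<alpha>))" for p
  have "\<exists>p\<ge>N. Q p" for N
  proof -
    obtain p where p: "p \<ge> N" "V (y p) < \<alpha>"
      using frequently_V_below[OF \<alpha>(1)] by (auto simp: frequently_sequentially)
    obtain q where q: "q \<ge> p" "V (y q) \<ge> \<beta>"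
      using high unfolding frequently_sequentially by blast
    define S where "S = {k \<in> {p..q}. V (y k) \<le> \<alpha>}"
    have S: "finite S" "p \<in> S" using p q by (auto simp: S_def)
    have "Max S \<in> S" using S Max_in by blast
    then have M: "V (y (Max S)) \<le> \<alpha>" "Max S \<ge> p" "Max S \<le> q" by (auto simp: S_def)
    have "Max S \<noteq> q" using M q \<alpha> by auto
    moreover have "V (y k) > \<alpha>" if "k \<in> {Max S<..<q}" for k
    proof (rule ccontr)
      assume "\<not> V (y k) > \<alpha>"
      then have "k \<in> S" using that M by (auto simp: S_def)
      then show False using Max_ge[OF S(1)] that by fastforce
    qed
    ultimately have "Q (Max S)" using M q by (auto simp: Q_def intro!: exI[of _ q])
    then show ?thesis using M p by (intro exI[of _ "Max S"]) auto
  qed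
  then have "\<exists>\<^sub>F p in sequentially. Q p" by (simp add: frequently_sequentially)
  then obtain \<sigma> p where \<sigma>: "strict_mono \<sigma>" "\<And>j. Q (\<sigma> j)" and lim: "(\<lambda>j. y (\<sigma> j)) \<longlonglongrightarrow> p"
    by (rule ex_cluster_point[where R = \<alpha>]) (auto simp: Q_def)
  have V\<sigma>: "(\<lambda>j. V (y (\<sigma> j))) \<longlonglongrightarrow> V p"
    using isCont_tendsto_compose[OF V_isCont lim] .
  then have "V p \<le> \<alpha>"
    using \<sigma>(2) by (intro LIMSEQ_le_const2[OF V\<sigma>] exI[of _ 0]) (simp add: Q_def)
  have "(\<lambda>j. y (Suc (\<sigma> j))) \<longlonglongrightarrow> p + 0 *\<^sub>R h p + 0"
  proof -
    have 1: "(\<lambda>j. h (y (\<sigma> j))) \<longlonglongrightarrow> h p"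
      using isCont_tendsto_compose[OF h_isCont lim] .
    have 2: "(\<lambda>j. a (\<sigma> j)) \<longlonglongrightarrow> 0"
      using LIMSEQ_subseq_LIMSEQ[OF a_lim \<sigma>(1)] by (simp add: o_def)
    obtain i :: nat where i: "\<alpha> \<le> i" using real_arch_simple by blast
    have "V (y (\<sigma> j)) \<le> i" for j using \<sigma>(2)[of j] i by (simp add: Q_def)
    then have 3: "(\<lambda>j. e (\<sigma> j)) \<longlonglongrightarrow> 0"
      using LIMSEQ_subseq_LIMSEQ[OF summable_LIMSEQ_zero[OF noise[of i]] \<sigma>(1)]
      by (simp add: o_def)
    show ?thesis unfolding step by (rule tendsto_add[OF tendsto_add[OF lim tendsto_scaleR[OF 2 1]] 3])
  qed
  then have "(\<lambda>j. V (y (Suc (\<sigma> j)))) \<longlonglongrightarrow> V p"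
    by (intro isCont_tendsto_compose[OF V_isCont]) simp
  moreover have "V (y (Suc (\<sigma> j))) \<ge> \<alpha>" for j
  proof -
    obtain q where q: "q > \<sigma> j" "V (y q) \<ge> \<beta>" "\<forall>k\<in>{\<sigma> j<..<q}. V (y k) > \<alpha>"
      using \<sigma>(2)[of j] by (auto simp: Q_def)
    show ?thesis
      using q \<alpha> by (cases "q = Suc (\<sigma> j)") (auto intro!: less_imp_le)
  qed
  ultimately have "V p \<ge> \<alpha>" by (intro LIMSEQ_le_const[of _ "V p"]) auto
  then have Vp: "V p > 0" using \<alpha> by simp
  obtain \<Delta> \<rho> where \<Delta>: "\<Delta> > 0" "\<rho> > 0" and ev: "\<forall>\<^sub>F m in sequentially. dist (y m) p < \<rho> \<longrightarrow>
       (\<exists>n>m. V (y n) \<le> V p - \<Delta> \<and> (\<forall>k\<in>{m..n}. V (y k) < V p + (\<beta> - \<alpha>)))"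
    using descent_near[OF Vp, of "\<beta> - \<alpha>"] \<alpha> by auto
  have "\<forall>\<^sub>F j in sequentially. \<exists>n>\<sigma> j. V (y n) < \<alpha> \<and> (\<forall>k\<in>{\<sigma> j..n}. V (y k) < \<beta>)"
    using tendstoD[OF lim \<Delta>(2)] eventually_compose_filterlim[OF ev filterlim_subseq[OF \<sigma>(1)]]
    by eventually_elim (use \<open>V p \<le> \<alpha>\<close> \<Delta>(1) in force)
  then obtain j n where n: "n > \<sigma> j" "V (y n) < \<alpha>" "\<forall>k\<in>{\<sigma> j..n}. V (y k) < \<beta>"
    by (auto dest: eventually_happens)
  obtain q where q: "q > \<sigma> j" "V (y q) \<ge> \<beta>" "\<forall>k\<in>{\<sigma> j<..<q}. V (y k) > \<alpha>"
    using \<sigma>(2)[of j] by (auto simp: Q_def)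
  have "n < q" using n(3) q(1,2) by (meson atLeastAtMost_iff less_imp_le not_le)
  then show False using n q by force
qed

text \<open>
  The points of \<open>{p. V p \<le> 1}\<close> at distance at least \<open>d\<close> from the zero set form a compact set, on which
  \<open>V\<close> is bounded away from 0; a path along which \<open>V\<close> tends to 0 must leave it.
\<close>

theorem infdist_zero_set_tendsto_0:
  "(\<lambda>n. infdist (y n) {p. V p = 0}) \<longlonglongrightarrow> 0"
proof (rule order_tendstoI)
  fix d :: real assume "d < 0"
  then show "\<forall>\<^sub>F n in sequentially. d < infdist (y n) {p. V p = 0}"
    by (intro always_eventually allI less_le_trans[OF _ infdist_nonneg])
next
  fix d :: real assume d: "0 < d"
  define K where "K = {p. V p \<le> 1} \<inter> {p. d \<le> infdist p {p. V p = 0}}"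
  have "compact K" unfolding K_def
    by (intro compact_Int_closed compact_sublevel_V closed_Collect_le continuous_intros)
  have "\<exists>c>0. \<forall>p\<in>K. c \<le> V p"
  proof (cases "K = {}")
    case False
    then obtain p where p: "p \<in> K" "\<forall>q\<in>K. V p \<le> V q"
      using continuous_attains_inf[OF \<open>compact K\<close> _ V_cont] by blast
    have "V p \<noteq> 0" using p(1) d by (auto simp: K_def)
    then have "V p > 0" using V_nonneg[of p] by linarith
    then show ?thesis using p(2) by blast
  qed (auto intro: exI[of _ 1])
  then obtain c where c: "c > 0" "\<And>p. p \<in> K \<Longrightarrow> c \<le> V p" by blast
  have "\<forall>\<^sub>F n in sequentially. V (y n) < min 1 c"
    using c by (intro eventually_V_below) simp
  then show "\<forall>\<^sub>F n in sequentially. infdist (y n) {p. V p = 0} < d"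
  proof eventually_elim
    case (elim n)
    then have "y n \<notin> K" using c(2)[of "y n"] by auto
    then show ?case using elim by (auto simp: K_def)
  qed
qed

end

section \<open>Convergence of square integrable martingale difference series\<close>

lemma integrable_mult_of_squares:
  fixes f g :: "'w \<Rightarrow> real"
  assumes [measurable]: "f \<in> borel_measurable P" "g \<in> borel_measurable P"
    and "integrable P (\<lambda>w. (f w)\<^sup>2)" "integrable P (\<lambda>w. (g w)\<^sup>2)"
  shows "integrable P (\<lambda>w. f w * g w)"
proof (rule Bochner_Integration.integrable_bound)
  show "integrable P (\<lambda>w. (f w)\<^sup>2 + (g w)\<^sup>2)" using assms by simp
  have "\<bar>u * v\<bar> \<le> u\<^sup>2 + v\<^sup>2" for u v :: real
  proof -
    have "2 * (\<bar>u\<bar> * \<bar>v\<bar>) \<le> \<bar>u\<bar>\<^sup>2 + \<bar>v\<bar>\<^sup>2"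
      using sum_squares_bound[of "\<bar>u\<bar>" "\<bar>v\<bar>"] by (simp add: mult.assoc)
    moreover have "0 \<le> \<bar>u\<bar> * \<bar>v\<bar>" by simp
    ultimately show ?thesis unfolding abs_mult power2_abs by linarith
  qed
  then show "AE w in P. norm (f w * g w) \<le> norm ((f w)\<^sup>2 + (g w)\<^sup>2)" by simp
qed simp

locale square_integrable_mds = prob_space P
  for P :: "'w measure" +
  fixes F :: "nat \<Rightarrow> 'w measure" and D :: "nat \<Rightarrow> 'w \<Rightarrow> real"
  assumes subalg: "\<And>n. subalgebra P (F n)"
    and mono: "\<And>n. sets (F n) \<subseteq> sets (F (Suc n))"
    and adapted: "\<And>n. D n \<in> borel_measurable (F (Suc n))"
    and square: "\<And>n. integrable P (\<lambda>w. (D n w)\<^sup>2)"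
    and centred: "\<And>n. AE w in P. real_cond_exp P (F n) (D n) w = 0"
begin

lemma space_F: "space (F n) = space P"
  using subalg by (simp add: subalgebra_def)

lemma measurable_D [measurable]: "D n \<in> borel_measurable P"
  using measurable_from_subalg[OF subalg adapted] .

lemma subalg_mono: "m \<le> n \<Longrightarrow> subalgebra (F n) (F m)"
proof (induction n rule: dec_induct)
  case (step n)
  then show ?case using mono[of n] by (auto simp: subalgebra_def space_F)
qed (simp add: subalgebra_def)

lemma adapted_le: "k < n \<Longrightarrow> D k \<in> borel_measurable (F n)"
  using measurable_from_subalg[OF subalg_mono adapted, of k n] by simp

text \<open>
  Conditioning on \<open>F n\<close> pulls the factor \<open>Y\<close> out of the conditional expectation, which vanishes. Applied
  to partial sums, this removes the cross terms from second moments.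
\<close>

lemma orthogonal:
  assumes Y: "Y \<in> borel_measurable (F n)" and int: "integrable P (\<lambda>w. Y w * D n w)"
  shows "(\<integral>w. Y w * D n w \<partial>P) = 0"
proof -
  interpret F: finite_measure_subalgebra P "F n"
    by unfold_locales (rule subalg)
  have [measurable]: "Y \<in> borel_measurable P" using measurable_from_subalg[OF subalg Y] .
  have "(\<integral>w. Y w * D n w \<partial>P) = (\<integral>w. Y w * real_cond_exp P (F n) (D n) w \<partial>P)"
    using F.real_cond_exp_intg(2)[OF int Y] by simp
  also have "\<dots> = (\<integral>w. 0 \<partial>P)"
  proof (rule integral_cong_AE)
    show "AE w in P. Y w * real_cond_exp P (F n) (D n) w = 0"
      using centred[of n] by eventually_elim simp
  qed measurable
  finally show ?thesis by simp
qed

lemma square_integrable_predictable: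
  assumes G: "G \<in> borel_measurable (F n)" and bd: "\<And>w. \<bar>G w\<bar> \<le> 1"
  shows "integrable P (\<lambda>w. (G w * D n w)\<^sup>2)"
    and "(\<integral>w. (G w * D n w)\<^sup>2 \<partial>P) \<le> (\<integral>w. (D n w)\<^sup>2 \<partial>P)"
proof -
  have [measurable]: "G \<in> borel_measurable P" using measurable_from_subalg[OF subalg G] .
  have le: "(G w * D n w)\<^sup>2 \<le> (D n w)\<^sup>2" for w
    using mult_right_mono[OF bd[of w], of "\<bar>D n w\<bar>"] by (simp add: abs_le_square_iff[symmetric] abs_mult)
  show int: "integrable P (\<lambda>w. (G w * D n w)\<^sup>2)"
    by (rule Bochner_Integration.integrable_bound[OF square[of n]]) (use le in auto)
  show "(\<integral>w. (G w * D n w)\<^sup>2 \<partial>P) \<le> (\<integral>w. (D n w)\<^sup>2 \<partial>P)"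
    by (rule integral_mono[OF int square le])
qed

text \<open>
  Predictable weights \<open>G\<close> preserve orthogonality. The weights needed are indicators that stop the
  partial sums at a random time.
\<close>

lemma second_moment_transform:
  assumes G: "\<And>n. G n \<in> borel_measurable (F n)" and bd: "\<And>n w. \<bar>G n w\<bar> \<le> 1" and "m \<le> n"
  shows "integrable P (\<lambda>w. (\<Sum>k\<in>{m..<n}. G k w * D k w)\<^sup>2) \<and>
    (\<integral>w. (\<Sum>k\<in>{m..<n}. G k w * D k w)\<^sup>2 \<partial>P) \<le> (\<Sum>k\<in>{m..<n}. \<integral>w. (D k w)\<^sup>2 \<partial>P)"
  using \<open>m \<le> n\<close>
proof (induction n rule: dec_induct)
  case (step n)
  have [measurable]: "G k \<in> borel_measurable P" for k
    using measurable_from_subalg[OF subalg G] .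
  define T where "T w = (\<Sum>k\<in>{m..<n}. G k w * D k w)" for w
  have TF: "T \<in> borel_measurable (F n)"
    unfolding T_def
    by (intro borel_measurable_sum borel_measurable_times adapted_le
        measurable_from_subalg[OF subalg_mono G]) auto
  have TP [measurable]: "T \<in> borel_measurable P" unfolding T_def by measurable
  have intT: "integrable P (\<lambda>w. (T w)\<^sup>2)"
    and leT: "(\<integral>w. (T w)\<^sup>2 \<partial>P) \<le> (\<Sum>k\<in>{m..<n}. \<integral>w. (D k w)\<^sup>2 \<partial>P)"
    using step.IH by (auto simp: T_def)
  note sq = square_integrable_predictable[OF G[of n] bd[of n]]
  have cross: "integrable P (\<lambda>w. T w * (G n w * D n w))"
    by (rule integrable_mult_of_squares[OF _ _ intT sq(1)]) measurable
  have "(\<integral>w. (T w * G n w) * D n w \<partial>P) = 0"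
    by (rule orthogonal) (use TF G cross in \<open>auto simp: mult.assoc\<close>)
  then have cross0: "(\<integral>w. T w * (G n w * D n w) \<partial>P) = 0" by (simp add: mult.assoc)
  have eq: "(\<Sum>k\<in>{m..<Suc n}. G k w * D k w)\<^sup>2 =
      (T w)\<^sup>2 + 2 * (T w * (G n w * D n w)) + (G n w * D n w)\<^sup>2" for w
    using step.hyps by (simp add: T_def power2_sum)
  have "(\<integral>w. (\<Sum>k\<in>{m..<Suc n}. G k w * D k w)\<^sup>2 \<partial>P) =
      (\<integral>w. (T w)\<^sup>2 \<partial>P) + (\<integral>w. (G n w * D n w)\<^sup>2 \<partial>P)"
    unfolding eq using intT cross sq(1) cross0 by simp
  then show ?case
    unfolding eq using intT cross sq leT step.hyps by simp
qed simp

text \<open>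
  Kolmogorov's maximal inequality. Stop the partial sums at the first time they reach \<open>\<delta>\<close> in modulus.
  If they reach it at all up to time \<open>n\<close>, then the stopped sum \<open>T n\<close> at time \<open>n\<close> is still at least \<open>\<delta>\<close>
  in modulus, so Chebyshev's inequality for \<open>T n\<close> suffices.
\<close>

lemma maximal_inequality:
  assumes \<delta>: "\<delta> > 0" and "m \<le> n"
  shows "prob {w \<in> space P. \<exists>k\<in>{m..n}. \<bar>\<Sum>j\<in>{m..<k}. D j w\<bar> \<ge> \<delta>}
    \<le> (\<Sum>k\<in>{m..<n}. \<integral>w. (D k w)\<^sup>2 \<partial>P) / \<delta>\<^sup>2"
proof -
  define S where "S k w = (\<Sum>j\<in>{m..<k}. D j w)" for k w
  define G where "G k w = (if \<forall>j\<in>{m..k}. \<bar>S j w\<bar> < \<delta> then 1 else 0 :: real)" for k w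
  define T where "T k w = (\<Sum>j\<in>{m..<k}. G j w * D j w)" for k w
  have SF: "S k \<in> borel_measurable (F n)" if "k \<le> n" for k n
    unfolding S_def using that by (intro borel_measurable_sum adapted_le) auto
  have GF: "G k \<in> borel_measurable (F k)" for k
  proof -
    have [measurable]: "Measurable.pred (F k) (\<lambda>w. \<forall>j\<in>{m..k}. \<bar>S j w\<bar> < \<delta>)"
    proof (rule pred_intros_finite(3))
      fix j assume "j \<in> {m..k}"
      then have [measurable]: "S j \<in> borel_measurable (F k)" using SF by simp
      show "Measurable.pred (F k) (\<lambda>w. \<bar>S j w\<bar> < \<delta>)" by measurable
    qed simp
    show ?thesis unfolding G_def by measurable
  qed
  have G1: "\<bar>G k w\<bar> \<le> 1" for k w by (simp add: G_def)
  have [measurable]: "G k \<in> borel_measurable P" for k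
    using measurable_from_subalg[OF subalg GF] .
  have [measurable]: "T k \<in> borel_measurable P" "S k \<in> borel_measurable P" for k
    unfolding T_def S_def by measurable
  have stopped: "\<bar>T n w\<bar> \<ge> \<delta>" if "k \<in> {m..n}" "\<bar>S k w\<bar> \<ge> \<delta>" for k w
  proof -
    define \<tau> where "\<tau> = (LEAST k. m \<le> k \<and> \<bar>S k w\<bar> \<ge> \<delta>)"
    have \<tau>: "m \<le> \<tau>" "\<bar>S \<tau> w\<bar> \<ge> \<delta>"
      using LeastI[of "\<lambda>k. m \<le> k \<and> \<bar>S k w\<bar> \<ge> \<delta>" k] that by (auto simp: \<tau>_def)
    have "\<tau> \<le> n"
      using Least_le[of "\<lambda>k. m \<le> k \<and> \<bar>S k w\<bar> \<ge> \<delta>" k] that by (auto simp: \<tau>_def)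
    have before: "\<bar>S j w\<bar> < \<delta>" if "m \<le> j" "j < \<tau>" for j
      using not_less_Least[of j "\<lambda>k. m \<le> k \<and> \<bar>S k w\<bar> \<ge> \<delta>"] that by (auto simp: \<tau>_def)
    have "T n w = (\<Sum>j\<in>{m..<\<tau>}. G j w * D j w) + (\<Sum>j\<in>{\<tau>..<n}. G j w * D j w)"
      unfolding T_def using \<tau>(1) \<open>\<tau> \<le> n\<close> by (simp add: sum.atLeastLessThan_concat)
    also have "(\<Sum>j\<in>{m..<\<tau>}. G j w * D j w) = S \<tau> w"
      unfolding S_def by (rule sum.cong) (use before in \<open>auto simp: G_def\<close>)
    also have "(\<Sum>j\<in>{\<tau>..<n}. G j w * D j w) = 0"
      by (rule sum.neutral) (use \<tau> in \<open>force simp: G_def\<close>)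
    finally show ?thesis using \<tau>(2) by simp
  qed
  note mom = second_moment_transform[OF GF G1 \<open>m \<le> n\<close>, folded T_def]
  have "prob {w \<in> space P. \<exists>k\<in>{m..n}. \<bar>S k w\<bar> \<ge> \<delta>} \<le> prob {w \<in> space P. \<bar>T n w\<bar> \<ge> \<delta>}"
    by (rule finite_measure_mono) (use stopped in auto)
  also have "\<dots> \<le> (\<integral>w. (T n w)\<^sup>2 \<partial>P) / \<delta>\<^sup>2"
    using mom \<delta> by (intro second_moment_method) auto
  also have "\<dots> \<le> (\<Sum>k\<in>{m..<n}. \<integral>w. (D k w)\<^sup>2 \<partial>P) / \<delta>\<^sup>2"
    using mom by (intro divide_right_mono) auto
  finally show ?thesis by (simp add: S_def)
qed

text \<open>
  The maximal inequality on \<open>{m..n}\<close> is uniform in \<open>n\<close>, and its bound is the tail of a convergent series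
  in \<open>m\<close>. The event that the sums started at \<open>m\<close> reach \<open>\<delta>\<close> for every \<open>m\<close> is therefore null.
\<close>

lemma AE_partial_sums_small:
  assumes sum: "summable (\<lambda>n. \<integral>w. (D n w)\<^sup>2 \<partial>P)" and \<delta>: "\<delta> > 0"
  shows "AE w in P. \<exists>m. \<forall>k\<ge>m. \<bar>\<Sum>j\<in>{m..<k}. D j w\<bar> < \<delta>"
proof -
  define q where "q n = (\<integral>w. (D n w)\<^sup>2 \<partial>P)" for n
  have q0: "q n \<ge> 0" for n by (simp add: q_def)
  define B where "B m n = {w \<in> space P. \<exists>k\<in>{m..n}. \<bar>\<Sum>j\<in>{m..<k}. D j w\<bar> \<ge> \<delta>}" for m n
  define A where "A m = (\<Union>n. B m n)" for m
  have B_meas: "B m n \<in> sets P" for m n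
    unfolding B_def by measurable
  have A_meas: "A m \<in> sets P" for m unfolding A_def using B_meas by blast
  have bound: "prob (A m) \<le> (\<Sum>k. q (k + m)) / \<delta>\<^sup>2" for m
  proof (rule LIMSEQ_le_const2)
    show "(\<lambda>n. prob (B m n)) \<longlonglongrightarrow> prob (A m)"
      unfolding A_def
    proof (rule finite_Lim_measure_incseq)
      show "incseq (B m)" by (rule incseq_SucI) (auto simp: B_def)
    qed (use B_meas in auto)
    have "prob (B m n) \<le> (\<Sum>k. q (k + m)) / \<delta>\<^sup>2" if "n \<ge> m" for n
    proof -
      have "prob (B m n) \<le> (\<Sum>k\<in>{m..<n}. q k) / \<delta>\<^sup>2"
        unfolding B_def q_def by (rule maximal_inequality[OF \<delta> that])
      also have "(\<Sum>k\<in>{m..<n}. q k) = (\<Sum>k<n - m. q (k + m))"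
        using that sum.shift_bounds_nat_ivl[of q 0 m "n - m"] by (simp add: lessThan_atLeast0)
      also have "(\<Sum>k<n - m. q (k + m)) \<le> (\<Sum>k. q (k + m))"
        using summable_ignore_initial_segment[OF sum, of m] q0
        by (intro sum_le_suminf) (auto simp: q_def)
      finally show ?thesis by (simp add: divide_right_mono)
    qed
    then show "\<exists>N. \<forall>n\<ge>N. prob (B m n) \<le> (\<Sum>k. q (k + m)) / \<delta>\<^sup>2" by blast
  qed
  have "(\<lambda>m. (\<Sum>k. q (k + m)) / \<delta>\<^sup>2) \<longlonglongrightarrow> 0 / \<delta>\<^sup>2"
    using sum \<delta> by (intro tendsto_divide suminf_exist_split2 tendsto_const) (auto simp: q_def)
  then have tail: "(\<lambda>m. (\<Sum>k. q (k + m)) / \<delta>\<^sup>2) \<longlonglongrightarrow> 0" by simp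
  have "prob (\<Inter>m. A m) \<le> 0"
  proof (rule LIMSEQ_le_const[OF tail])
    have "prob (\<Inter>m. A m) \<le> prob (A m)" for m
      using A_meas by (intro finite_measure_mono) auto
    then show "\<exists>N. \<forall>n\<ge>N. prob (\<Inter>m. A m) \<le> (\<Sum>k. q (k + n)) / \<delta>\<^sup>2"
      using bound order_trans by blast
  qed
  then have "(\<Inter>m. A m) \<in> null_sets P"
    using A_meas by (intro null_setsI) (auto simp: emeasure_eq_measure measure_le_0_iff)
  then show ?thesis
  proof (rule AE_I', safe)
    fix w m assume "w \<in> space P" "\<nexists>m. \<forall>k\<ge>m. \<bar>\<Sum>j\<in>{m..<k}. D j w\<bar> < \<delta>"
    then obtain k where "k \<ge> m" "\<bar>\<Sum>j\<in>{m..<k}. D j w\<bar> \<ge> \<delta>"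
      by (meson not_less)
    then show "w \<in> A m"
      using \<open>w \<in> space P\<close> by (auto simp: A_def B_def intro!: exI[of _ k] bexI[of _ k])
  qed
qed

theorem AE_summable:
  assumes sum: "summable (\<lambda>n. \<integral>w. (D n w)\<^sup>2 \<partial>P)"
  shows "AE w in P. summable (\<lambda>n. D n w)"
proof -
  have "AE w in P. \<forall>i. \<exists>m. \<forall>k\<ge>m. \<bar>\<Sum>j\<in>{m..<k}. D j w\<bar> < inverse (Suc i)"
    by (subst AE_all_countable) (auto intro!: AE_partial_sums_small[OF sum])
  then show ?thesis
  proof eventually_elim
    case (elim w)
    show ?case
      unfolding summable_Cauchy
    proof (intro allI impI)
      fix e :: real assume "e > 0"
      then obtain i where i: "inverse (Suc i) < e / 2"
        using reals_Archimedean[of "e / 2"] by auto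
      obtain N where N: "\<And>k. k \<ge> N \<Longrightarrow> \<bar>\<Sum>j\<in>{N..<k}. D j w\<bar> < e / 2"
        using elim i less_trans by meson
      have "norm (\<Sum>j\<in>{m..<n}. D j w) < e" if "m \<ge> N" for m n
      proof (cases "m \<le> n")
        case True
        then have "(\<Sum>j\<in>{m..<n}. D j w) = (\<Sum>j\<in>{N..<n}. D j w) - (\<Sum>j\<in>{N..<m}. D j w)"
          using that by (simp add: sum_diff_nat_ivl)
        then show ?thesis using N[of n] N[of m] that True by (simp add: abs_le_iff)
      qed (use \<open>e > 0\<close> in simp)
      then show "\<exists>N. \<forall>m\<ge>N. \<forall>n. norm (\<Sum>j\<in>{m..<n}. D j w) < e" by blast
    qed
  qed
qed

end

section \<open>The filtration of the noise and the iterates\<close>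

lemma space_noise_filtration: "space (noise_filtration P X M n) = space P"
  unfolding noise_filtration_def by (intro space_measure_of) auto

lemma sets_noise_filtration:
  "sets (noise_filtration P X M n) = sigma_sets (space P)
     ({X -` A \<inter> space P | A. A \<in> sets borel} \<union>
      {M k -` A \<inter> space P | k A. k \<in> {1..n} \<and> A \<in> sets borel})"
  unfolding noise_filtration_def by (intro sets_measure_of) auto

lemma sets_noise_filtration_Suc:
  "sets (noise_filtration P X M n) \<subseteq> sets (noise_filtration P X M (Suc n))"
proof -
  have "{M k -` A \<inter> space P | k A. k \<in> {1..n} \<and> A \<in> sets borel}
      \<subseteq> {M k -` A \<inter> space P | k A. k \<in> {1..Suc n} \<and> A \<in> sets borel}"
    by (intro Collect_mono impI) (elim exE conjE, intro exI conjI, auto)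
  then show ?thesis
    unfolding sets_noise_filtration by (intro sigma_sets_mono' Un_mono subset_refl)
qed

lemma subalgebra_noise_filtration:
  assumes "X \<in> borel_measurable P" and "\<And>n. M (Suc n) \<in> borel_measurable P"
  shows "subalgebra P (noise_filtration P X M n)"
proof -
  have "M k \<in> borel_measurable P" if "k \<in> {1..n}" for k
    using assms(2)[of "k - 1"] that by simp
  then have "{X -` A \<inter> space P | A. A \<in> sets borel} \<union>
      {M k -` A \<inter> space P | k A. k \<in> {1..n} \<and> A \<in> sets borel} \<subseteq> sets P"
    by (auto intro: measurable_sets[OF assms(1)] measurable_sets[of "M _" P borel])
  then show ?thesis
    unfolding subalgebra_def space_noise_filtration sets_noise_filtration
    by (intro conjI refl sets.sigma_sets_subset)
qed

lemma initial_measurable_noise_filtration: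
  fixes X :: "'a \<Rightarrow> real ^ 'b"
  shows "X \<in> borel_measurable (noise_filtration P X M n)"
proof (rule measurableI)
  fix A :: "(real ^ 'b) set" assume "A \<in> sets borel"
  then show "X -` A \<inter> space (noise_filtration P X M n) \<in> sets (noise_filtration P X M n)"
    unfolding space_noise_filtration sets_noise_filtration
    by (intro sigma_sets.Basic UnI1 CollectI exI[of _ A] conjI refl)
qed simp

lemma noise_measurable_noise_filtration:
  fixes M :: "nat \<Rightarrow> 'a \<Rightarrow> real ^ 'b"
  assumes "k \<in> {1..n}"
  shows "M k \<in> borel_measurable (noise_filtration P X M n)"
proof (rule measurableI)
  fix A :: "(real ^ 'b) set" assume "A \<in> sets borel"
  then show "M k -` A \<inter> space (noise_filtration P X M n) \<in> sets (noise_filtration P X M n)"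
    unfolding space_noise_filtration sets_noise_filtration
    using assms by (intro sigma_sets.Basic UnI2 CollectI exI[of _ k] exI[of _ A] conjI refl)
qed simp

lemma noise_filtration_mono_measurable:
  assumes "f \<in> borel_measurable (noise_filtration P X M n)"
  shows "f \<in> borel_measurable (noise_filtration P X M (Suc n))"
proof (rule measurable_from_subalg[OF _ assms])
  show "subalgebra (noise_filtration P X M (Suc n)) (noise_filtration P X M n)"
    unfolding subalgebra_def space_noise_filtration
    by (intro conjI refl sets_noise_filtration_Suc)
qed

lemma iterates_adapted:
  fixes h :: "real ^ 'd \<Rightarrow> real ^ 'd"
  assumes h: "continuous_on UNIV h"
    and iter: "\<And>n w. w \<in> space P \<Longrightarrow>
      x (Suc n) w = x n w + a n *\<^sub>R (h (x n w) + M (Suc n) w)"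
  shows "x n \<in> borel_measurable (noise_filtration P (x 0) M n)"
proof (induction n)
  case 0
  show ?case by (rule initial_measurable_noise_filtration)
next
  case (Suc n)
  let ?F = "noise_filtration P (x 0) M (Suc n)"
  have [measurable]: "h \<in> borel_measurable borel"
    using h by (rule borel_measurable_continuous_onI)
  have [measurable]: "x n \<in> borel_measurable ?F"
    using Suc.IH by (rule noise_filtration_mono_measurable)
  have [measurable]: "M (Suc n) \<in> borel_measurable ?F"
    by (rule noise_measurable_noise_filtration) simp
  have "(\<lambda>w. x n w + a n *\<^sub>R (h (x n w) + M (Suc n) w)) \<in> borel_measurable ?F"
    by measurable
  moreover have "x (Suc n) \<in> borel_measurable ?F \<longleftrightarrow>
      (\<lambda>w. x n w + a n *\<^sub>R (h (x n w) + M (Suc n) w)) \<in> borel_measurable ?F"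
    by (rule measurable_cong) (rule iter, simp only: space_noise_filtration)
  ultimately show ?case by (simp only:)
qed

section \<open>Summability of the noise along bounded parts of a path\<close>

text \<open>
  On \<open>x n \<in> B\<close> the conditional variance of the noise is bounded by the constant \<open>K\<close> below, so the
  truncated terms have second moments at most \<open>K * (a n)\<^sup>2\<close>. The scalar convergence theorem is applied
  to each coordinate.
\<close>

lemma AE_truncated_noise_summable:
  fixes P :: "'w measure" and x M :: "nat \<Rightarrow> 'w \<Rightarrow> real ^ 'd"
  defines "F \<equiv> noise_filtration P (x 0) M"
  assumes prob: "prob_space P"
    and subalg: "\<And>n. subalgebra P (F n)"
    and x_adapted: "\<And>n. x n \<in> borel_measurable (F n)"
    and M_meas: "\<And>n. M (Suc n) \<in> borel_measurable P"
    and a_sq: "summable (\<lambda>n. (a n)\<^sup>2)"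
    and M_sq: "\<And>n. integrable P (\<lambda>w. (norm (M (Suc n) w))\<^sup>2)"
    and M_diff: "\<And>n. AE w in P. vec_cond_exp P (F n) (M (Suc n)) w = 0"
    and M_var: "\<And>n. AE w in P. real_cond_exp P (F n) (\<lambda>v. (norm (M (Suc n) v))\<^sup>2) w
        \<le> c * (1 + (norm (x n w))\<^sup>2)"
    and B: "bounded B" "B \<in> sets borel" and c: "c > 0"
  shows "AE w in P. summable (\<lambda>n. if x n w \<in> B then a n *\<^sub>R M (Suc n) w else 0)"
proof -
  interpret prob_space P by (rule prob)
  note [measurable] = M_meas B(2)
  obtain C where C: "\<And>p. p \<in> B \<Longrightarrow> norm p \<le> C" "C > 0"
    using B(1) bounded_pos by blast
  have x_meas [measurable]: "x n \<in> borel_measurable P" for n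
    using measurable_from_subalg[OF subalg x_adapted] .
  define G where "G n w = (indicator B (x n w) :: real)" for n w
  have G_meas: "G n \<in> borel_measurable (F n)" for n
    unfolding G_def using x_adapted[of n] by measurable
  have [measurable]: "G n \<in> borel_measurable P" for n
    using measurable_from_subalg[OF subalg G_meas] .
  have G01: "0 \<le> G n w" "G n w \<le> 1" "(G n w)\<^sup>2 = G n w" for n w
    by (auto simp: G_def indicator_def)
  define K where "K = c * (1 + C\<^sup>2)"
  have energy_int: "integrable P (\<lambda>w. G n w * (norm (M (Suc n) w))\<^sup>2)" for n
    by (rule Bochner_Integration.integrable_bound[OF M_sq[of n]])
      (auto simp: G01 mult_left_le_one_le)
  have energy: "(\<integral>w. G n w * (norm (M (Suc n) w))\<^sup>2 \<partial>P) \<le> K" for n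
  proof -
    interpret F: finite_measure_subalgebra P "F n"
      by unfold_locales (rule subalg)
    let ?E = "real_cond_exp P (F n) (\<lambda>v. (norm (M (Suc n) v))\<^sup>2)"
    have "(\<integral>w. G n w * (norm (M (Suc n) w))\<^sup>2 \<partial>P) = (\<integral>w. G n w * ?E w \<partial>P)"
      by (rule F.real_cond_exp_intg(2)[symmetric, OF energy_int G_meas]) measurable
    also have "\<dots> \<le> (\<integral>w. K \<partial>P)"
    proof (rule integral_mono_AE)
      show "integrable P (\<lambda>w. G n w * ?E w)"
        by (rule F.real_cond_exp_intg(1)[OF energy_int G_meas]) measurable
      show "AE w in P. G n w * ?E w \<le> K"
        using M_var[of n]
      proof eventually_elim
        case (elim w)
        show ?case
        proof (cases "x n w \<in> B")
          case True
          have "(norm (x n w))\<^sup>2 \<le> C\<^sup>2" using C(1)[OF True] by (simp add: power_mono)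
          then have "c * (1 + (norm (x n w))\<^sup>2) \<le> K" using c by (simp add: K_def)
          then show ?thesis using elim True by (simp add: G_def)
        next
          case False
          then show ?thesis using c by (simp add: G_def K_def)
        qed
      qed
    qed simp
    finally show ?thesis by (simp add: prob_space)
  qed
  have comp: "AE w in P. summable (\<lambda>n. a n * G n w * M (Suc n) w $ i)" for i
  proof -
    have comp_sq_le: "(M (Suc n) w $ i)\<^sup>2 \<le> (norm (M (Suc n) w))\<^sup>2" for n w
      using component_le_norm_cart[of "M (Suc n) w" i] by (simp add: abs_le_square_iff[symmetric])
    have comp_meas [measurable]: "(\<lambda>w. M (Suc n) w $ i) \<in> borel_measurable P" for n
      by (rule measurable_compose[OF M_meas borel_measurable_nth])
    have comp_sq: "integrable P (\<lambda>w. (M (Suc n) w $ i)\<^sup>2)" for n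
      by (rule Bochner_Integration.integrable_bound[OF M_sq[of n]]) (auto simp: comp_sq_le)
    have comp_int: "integrable P (\<lambda>w. M (Suc n) w $ i)" for n
      by (rule square_integrable_imp_integrable[OF comp_meas comp_sq])
    have D_int: "integrable P (\<lambda>w. a n * G n w * M (Suc n) w $ i)" for n
      by (rule Bochner_Integration.integrable_bound[OF integrable_mult_right[OF comp_int[of n], of "a n"]])
        (auto simp: G01 abs_mult mult_left_le_one_le mult.assoc intro!: mult_left_mono)
    have D_sq_eq: "(a n * G n w * M (Suc n) w $ i)\<^sup>2 = (a n)\<^sup>2 * (G n w * (M (Suc n) w $ i)\<^sup>2)" for n w
      by (simp add: power_mult_distrib G01)
    have D_sq_le: "(a n * G n w * M (Suc n) w $ i)\<^sup>2 \<le> (a n)\<^sup>2 * (G n w * (norm (M (Suc n) w))\<^sup>2)" for n w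
      unfolding D_sq_eq using comp_sq_le by (intro mult_left_mono) (auto simp: G01)
    have D_sq: "integrable P (\<lambda>w. (a n * G n w * M (Suc n) w $ i)\<^sup>2)" for n
      by (rule Bochner_Integration.integrable_bound[OF integrable_mult_right[OF energy_int, of "(a n)\<^sup>2"]])
        (use D_sq_le G01 in auto)
    interpret square_integrable_mds P F "\<lambda>n w. a n * G n w * M (Suc n) w $ i"
    proof
      fix n
      show "sets (F n) \<subseteq> sets (F (Suc n))"
        unfolding F_def by (rule sets_noise_filtration_Suc)
      have [measurable]: "M (Suc n) \<in> borel_measurable (F (Suc n))"
        unfolding F_def by (rule noise_measurable_noise_filtration) simp
      have [measurable]: "G n \<in> borel_measurable (F (Suc n))"
        using G_meas[of n] unfolding F_def by (rule noise_filtration_mono_measurable)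
      have [measurable]: "(\<lambda>w. M (Suc n) w $ i) \<in> borel_measurable (F (Suc n))"
        by (rule measurable_compose[OF _ borel_measurable_nth]) measurable
      show "(\<lambda>w. a n * G n w * M (Suc n) w $ i) \<in> borel_measurable (F (Suc n))"
        by measurable
      interpret F: finite_measure_subalgebra P "F n"
        by unfold_locales (rule subalg)
      have "AE w in P. real_cond_exp P (F n) (\<lambda>w. a n * G n w * M (Suc n) w $ i) w =
          a n * G n w * real_cond_exp P (F n) (\<lambda>w. M (Suc n) w $ i) w"
        using G_meas[of n] D_int by (intro F.real_cond_exp_mult) auto
      then show "AE w in P. real_cond_exp P (F n) (\<lambda>w. a n * G n w * M (Suc n) w $ i) w = 0"
        using M_diff[of n]
      proof eventually_elim
        case (elim w)
        have "real_cond_exp P (F n) (\<lambda>w. M (Suc n) w $ i) w = vec_cond_exp P (F n) (M (Suc n)) w $ i"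
          by (simp add: vec_cond_exp_def)
        then show ?case using elim by simp
      qed
    qed (use subalg D_sq in auto)
    show ?thesis
    proof (rule AE_summable, rule summable_comparison_test')
      show "summable (\<lambda>n. K * (a n)\<^sup>2)" using a_sq by (rule summable_mult)
      fix n :: nat assume "n \<ge> 0"
      have "(\<integral>w. (a n * G n w * M (Suc n) w $ i)\<^sup>2 \<partial>P)
          \<le> (\<integral>w. (a n)\<^sup>2 * (G n w * (norm (M (Suc n) w))\<^sup>2) \<partial>P)"
        using D_sq energy_int D_sq_le by (intro integral_mono) auto
      also have "\<dots> \<le> K * (a n)\<^sup>2"
        using mult_left_mono[OF energy[of n], of "(a n)\<^sup>2"] by (simp add: mult.commute)
      finally show "norm (\<integral>w. (a n * G n w * M (Suc n) w $ i)\<^sup>2 \<partial>P) \<le> K * (a n)\<^sup>2"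
        by simp
    qed
  qed
  have "AE w in P. \<forall>i. summable (\<lambda>n. a n * G n w * M (Suc n) w $ i)"
    using comp by (simp add: AE_all_countable)
  then show ?thesis
  proof eventually_elim
    case (elim w)
    have "summable (\<lambda>n. \<Sum>i\<in>UNIV. (a n * G n w * M (Suc n) w $ i) *\<^sub>R axis i 1 :: real ^ 'd)"
      using elim by (intro summable_sum summable_scaleR_left) auto
    moreover have "(\<Sum>i\<in>UNIV. (a n * G n w * M (Suc n) w $ i) *\<^sub>R axis i 1 :: real ^ 'd) =
        (if x n w \<in> B then a n *\<^sub>R M (Suc n) w else 0)" for n
      by (simp add: G_def vec_eq_iff axis_def if_distrib[of "\<lambda>u. _ * u"] cong: if_cong)
    ultimately show ?case by simp
  qed
qed

section \<open>Recurrence from tightness\<close>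

text \<open>
  Some iterate after time \<open>n\<close> lies in the ball of radius \<open>i\<close> with probability at least \<open>1 - \<epsilon>\<close>, for
  every \<open>n\<close>; these events decrease with \<open>n\<close>, so their intersection has probability at least
  \<open>1 - \<epsilon>\<close> as well.
\<close>

lemma tight_iterates_imp_AE_recurrent:
  fixes x :: "nat \<Rightarrow> 'w \<Rightarrow> real ^ 'd"
  assumes prob: "prob_space P" and tight: "tight_iterates P x"
    and x_meas: "\<And>n. x n \<in> borel_measurable P"
  shows "AE w in P. \<exists>i::nat. \<exists>\<^sub>F n in sequentially. norm (x n w) \<le> i"
proof -
  interpret prob_space P by (rule prob)
  note [measurable] = x_meas
  define E where "E i n = {w \<in> space P. norm (x n w) \<le> real i}" for i n
  define U where "U i n = (\<Union>k\<in>{n..}. E i k)" for i n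
  define W where "W = (\<Union>i. \<Inter>n. U i n)"
  have E_meas: "E i n \<in> sets P" for i n unfolding E_def by measurable
  have U_meas: "U i n \<in> sets P" for i n unfolding U_def using E_meas by auto
  have W_meas: "W \<in> sets P" unfolding W_def using U_meas by auto
  have large: "1 - \<epsilon> \<le> prob W" if \<epsilon>: "\<epsilon> > 0" for \<epsilon>
  proof -
    obtain K where K: "compact K" "\<And>n. prob {w \<in> space P. x n w \<in> K} > 1 - \<epsilon>"
      using tight[unfolded tight_iterates_def, rule_format, OF \<epsilon>] by blast
    obtain b where b: "\<And>p. p \<in> K \<Longrightarrow> norm p \<le> b"
      using compact_imp_bounded[OF K(1)] bounded_iff by blast
    obtain i :: nat where i: "b \<le> i" using real_arch_simple by blast
    have "1 - \<epsilon> \<le> prob (U i n)" for n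
    proof -
      have "{w \<in> space P. x n w \<in> K} \<subseteq> U i n"
        using b i by (force simp: U_def E_def)
      then show ?thesis
        using finite_measure_mono[OF _ U_meas] K(2)[of n] by (meson less_imp_le order_trans)
    qed
    moreover have "(\<lambda>n. prob (U i n)) \<longlonglongrightarrow> prob (\<Inter>n. U i n)"
    proof (rule finite_Lim_measure_decseq)
      show "decseq (U i)" unfolding U_def by (intro decseq_SucI UN_mono) auto
    qed (use U_meas in auto)
    ultimately have "1 - \<epsilon> \<le> prob (\<Inter>n. U i n)"
      by (intro LIMSEQ_le_const) auto
    also have "\<dots> \<le> prob W"
      using W_meas by (intro finite_measure_mono) (auto simp: W_def)
    finally show ?thesis .
  qed
  have "1 \<le> prob W"
  proof (rule field_le_epsilon)
    fix \<epsilon> :: real assume "\<epsilon> > 0"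
    from large[OF this] show "1 \<le> prob W + \<epsilon>" by linarith
  qed
  then have "prob W = 1" using prob_le_1[of W] by simp
  then have "AE w in P. w \<in> W" by (rule AE_prob_1)
  then show ?thesis
  proof eventually_elim
    case (elim w)
    then obtain i where "\<And>n. w \<in> U i n" by (auto simp: W_def)
    then have "\<forall>n. \<exists>k\<ge>n. norm (x k w) \<le> real i" by (auto simp: U_def E_def)
    then show ?case unfolding frequently_sequentially ..
  qed
qed

section \<open>Almost sure convergence to the zero set of the Liapunov function\<close>

theorem corollary2:
  fixes P :: "'w measure"
    and h :: "real ^ 'd \<Rightarrow> real ^ 'd"
    and a :: "nat \<Rightarrow> real"
    and x M :: "nat \<Rightarrow> 'w \<Rightarrow> real ^ 'd"
    and V :: "real ^ 'd \<Rightarrow> real"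
    and grad_V :: "real ^ 'd \<Rightarrow> real ^ 'd"
    and H :: "(real ^ 'd) set"
  assumes prob: "prob_space P"
    and x0_meas: "x 0 \<in> borel_measurable P"
    and M_meas: "\<And>n. M (Suc n) \<in> borel_measurable P"
    and iter: "\<And>n w. w \<in> space P \<Longrightarrow>
      x (Suc n) w = x n w + a n *\<^sub>R (h (x n w) + M (Suc n) w)"
    and h_lip: "\<exists>L. L-lipschitz_on UNIV h"
    and a_pos: "\<And>n. a n > 0"
    and a_sum: "filterlim (\<lambda>N. \<Sum>n<N. a n) at_top sequentially"
    and a_sq: "summable (\<lambda>n. (a n)\<^sup>2)"
    and a_mono: "\<exists>c>0. \<forall>m n. m \<le> n \<longrightarrow> a n \<le> c * a m"
    and M_sq: "\<And>n. integrable P (\<lambda>w. (norm (M (Suc n) w))\<^sup>2)"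
    and M_diff: "\<And>n. AE w in P.
      vec_cond_exp P (noise_filtration P (x 0) M n) (M (Suc n)) w = 0"
    and M_var: "\<exists>c>0. \<forall>n. AE w in P.
      real_cond_exp P (noise_filtration P (x 0) M n) (\<lambda>v. (norm (M (Suc n) v))\<^sup>2) w
        \<le> c * (1 + (norm (x n w))\<^sup>2)"
    and V_nonneg: "\<And>y. V y \<ge> 0"
    and V_grad: "\<And>y. GDERIV V y :> grad_V y"
    and V_inf: "filterlim V at_top at_infinity"
    and V_liap: "\<And>y. grad_V y \<bullet> h y \<le> 0"
    and H_def: "H = {y. grad_V y \<bullet> h y = 0}"
    and H_zero: "H = {y. V y = 0}"
    and tight: "tight_iterates P x"
  shows "AE w in P. (\<lambda>n. infdist (x n w) H) \<longlonglongrightarrow> 0"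
proof -
  obtain L where L: "L-lipschitz_on UNIV h" using h_lip by blast
  have h_cont: "continuous_on UNIV h" using L by (rule lipschitz_on_continuous_on)
  obtain c where c: "c > 0" and var: "\<And>n. AE w in P.
      real_cond_exp P (noise_filtration P (x 0) M n) (\<lambda>v. (norm (M (Suc n) v))\<^sup>2) w
        \<le> c * (1 + (norm (x n w))\<^sup>2)"
    using M_var by blast
  have V_cont: "continuous_on UNIV V"
    using V_grad unfolding gderiv_def
    by (meson continuous_at_imp_continuous_on has_derivative_continuous)
  have subalg: "subalgebra P (noise_filtration P (x 0) M n)" for n
    using x0_meas M_meas by (rule subalgebra_noise_filtration)
  have adapted: "x n \<in> borel_measurable (noise_filtration P (x 0) M n)" for n
    using h_cont iter by (rule iterates_adapted)
  have a_lim: "a \<longlonglongrightarrow> 0"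
    using tendsto_real_sqrt[OF summable_LIMSEQ_zero[OF a_sq]]
    by (simp add: tendsto_rabs_zero_iff)
  have "AE w in P. summable (\<lambda>n. if x n w \<in> {p. V p \<le> real R} then a n *\<^sub>R M (Suc n) w else 0)"
    for R :: nat
  proof -
    have "compact {p. V p \<le> real R}" using V_cont V_inf by (rule compact_sublevel)
    then show ?thesis
      by (intro AE_truncated_noise_summable[OF prob subalg adapted M_meas a_sq M_sq M_diff var _ _ c]
          compact_imp_bounded borel_compact)
  qed
  then have noise: "AE w in P. \<forall>R::nat.
      summable (\<lambda>n. if x n w \<in> {p. V p \<le> real R} then a n *\<^sub>R M (Suc n) w else 0)"
    by (simp add: AE_all_countable)
  have recurrent: "AE w in P. \<exists>i::nat. \<exists>\<^sub>F n in sequentially. norm (x n w) \<le> i"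
    using prob tight measurable_from_subalg[OF subalg adapted] by (rule tight_iterates_imp_AE_recurrent)
  show ?thesis
    using noise recurrent AE_space
  proof eventually_elim
    case (elim w)
    obtain i :: nat where i: "\<exists>\<^sub>F n in sequentially. norm (x n w) \<le> i"
      using elim(2) by blast
    obtain R where R: "\<And>p. norm p \<le> i \<Longrightarrow> V p \<le> R"
    proof -
      have "compact (V ` cball 0 (real i))"
        using continuous_on_subset[OF V_cont subset_UNIV] compact_cball
        by (rule compact_continuous_image)
      then obtain R where "\<And>v. v \<in> V ` cball 0 (real i) \<Longrightarrow> norm v \<le> R"
        using compact_imp_bounded bounded_iff by metis
      then have "V p \<le> R" if "norm p \<le> i" for p
        using that by (metis abs_le_D1 imageI mem_cball_0 real_norm_def)
      then show ?thesis by (rule that)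
    qed
    interpret noisy_euler_path h V grad_V a "\<lambda>n. x n w" "\<lambda>n. a n *\<^sub>R M (Suc n) w"
    proof
      show "grad_V p \<bullet> h p < 0" if "V p > 0" for p
      proof -
        have "p \<notin> H" using that H_zero by simp
        then have "grad_V p \<bullet> h p \<noteq> 0" using H_def by simp
        then show ?thesis using V_liap[of p] by simp
      qed
      show "x (Suc n) w = x n w + a n *\<^sub>R h (x n w) + a n *\<^sub>R M (Suc n) w" for n
        using iter[OF elim(3)] by (simp add: scaleR_add_right)
      show "summable (\<lambda>n. if V (x n w) \<le> real i then a n *\<^sub>R M (Suc n) w else 0)" for i
        using elim(1) by simp
      show "\<exists>R. \<exists>\<^sub>F n in sequentially. V (x n w) \<le> R"
        by (intro exI[of _ R]) (rule frequently_elim1[OF i], rule R)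
    qed (fact h_cont V_nonneg V_grad V_inf a_pos a_lim a_sum)+
    show ?case using infdist_zero_set_tendsto_0 H_zero by simp
  qed
qed

end
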